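(* Let $X$ and $Y$ be two quasi-metric spaces, and let $Q(X)$ and $Q(Y)$ be their $q$-hyperconvex hulls. Then $$d_{GH}(Q(X),Q(Y))\leq 8\,d_{GH}(X,Y).$$
   Context: A quasi-metric space is a set $X$ with a map $d\colon X\times X\to[0,\infty)$ such that $d(x,y)\leq d(x,z)+d(z,y)$ for all $x,y,z\in X$, and, for all $x,y\in X$, $d(x,y)=d(y,x)=0$ if and only if $x=y$ (symmetry is not required). Its symmetrisation is the metric $d^s(x,y)=\max\{d(x,y),d(y,x)\}$. An isometric embedding is a map $\varphi\colon (X,d_X)\to(Y,d_Y)$ with $d_Y(\varphi(x),\varphi(x'))=d_X(x,x')$ for all $x,x'\in X$. Gromov-Hausdorff distance for quasi-metric spaces: for a quasi-metric space $(Z,d)$ and $A,B\subseteq Z$, let $d_H^{\mathrm{Sym}}(A,B)\in[0,\infty]$ be the Hausdorff distance of $A$ and $B$ in the metric space $(Z,d^s)$, i.e. the infimum of the $r\geq 0$ such that every $a\in A$ has some $b\in B$ with $d^s(a,b)\leq r$ and every $b\in B$ has some $a\in A$ with $d^s(a,b)\le r$. For quasi-metric spaces $X,Y$, $d_{GH}(X,Y)\in[0,\infty]$ is the infimum of the $\varepsilon>0$ for which there exist a quasi-metric space $Z$ and isometric embeddings $i_X\colon X\to Z$, $i_Y\colon Y\to Z$ with $d_H^{\mathrm{Sym}}(i_X(X),i_Y(Y))<\varepsilon$. $q$-hyperconvex hull: for a quasi-metric space $(X,d)$, let $P(X)$ be the set of pairs $f=(f_1,f_2)$ of maps $f_i\colon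 X\to[0,\infty)$ such that $d(x,y)\leq f_2(x)+f_1(y)$ for all $x,y\in X$, partially ordered by $(f_1,f_2)\leq(g_1,g_2)$ iff $f_1\leq g_1$ and $f_2\leq g_2$ pointwise. $Q(X)\subseteq P(X)$ is the set of minimal elements, endowed with $$D(f,g)=\max\Big\{\sup_{x\in X}\max\{f_1(x)-g_1(x),0\},\ \sup_{x\in X}\max\{g_2(x)-f_2(x),0\}\Big\},$$ which is known to be a (finite-valued) quasi-metric on $Q(X)$. *)

theory Defs
  imports "HOL-Analysis.Analysis"
begin

section \<open>Quasi-metric spaces\<close>

text \<open>A space is a carrier set together with a distance function, whose values outside
  the carrier are irrelevant.  The empty space is allowed.\<close>

definition quasi_metric :: "'a set \<Rightarrow> ('a \<Rightarrow> 'a \<Rightarrow> real) \<Rightarrow> bool" where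
  "quasi_metric X d \<longleftrightarrow>
     (\<forall>x\<in>X. \<forall>y\<in>X. 0 \<le> d x y) \<and>
     (\<forall>x\<in>X. \<forall>y\<in>X. \<forall>z\<in>X. d x y \<le> d x z + d z y) \<and>
     (\<forall>x\<in>X. \<forall>y\<in>X. (d x y = 0 \<and> d y x = 0) \<longleftrightarrow> x = y)"

definition symmetrisation :: "('a \<Rightarrow> 'a \<Rightarrow> real) \<Rightarrow> 'a \<Rightarrow> 'a \<Rightarrow> real" where
  "symmetrisation d x y = max (d x y) (d y x)"

definition isometric_embedding ::
    "'a set \<Rightarrow> ('a \<Rightarrow> 'a \<Rightarrow> real) \<Rightarrow> 'b set \<Rightarrow> ('b \<Rightarrow> 'b \<Rightarrow> real) \<Rightarrow> ('a \<Rightarrow> 'b) \<Rightarrow> bool" where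
  "isometric_embedding X dX Y dY \<phi> \<longleftrightarrow>
     \<phi> \<in> X \<rightarrow> Y \<and> (\<forall>x\<in>X. \<forall>x'\<in>X. dY (\<phi> x) (\<phi> x') = dX x x')"


section \<open>Gromov-Hausdorff distance\<close>

definition hausdorff_Sym :: "('a \<Rightarrow> 'a \<Rightarrow> real) \<Rightarrow> 'a set \<Rightarrow> 'a set \<Rightarrow> ennreal" where
  "hausdorff_Sym d A B =
     Inf {ennreal r |r. 0 \<le> r \<and>
            (\<forall>a\<in>A. \<exists>b\<in>B. symmetrisation d a b \<le> r) \<and>
            (\<forall>b\<in>B. \<exists>a\<in>A. symmetrisation d a b \<le> r)}"

text \<open>The ambient space ranges over all quasi-metric spaces whose carrier is a subset of
  the sum type.  This is no restriction: only the union of the two images matters,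
  and it fits into the sum type; see \<open>ambient_in_sum_type\<close> and \<open>gromov_hausdorff_le\<close>.\<close>

definition gromov_hausdorff ::
    "'a set \<Rightarrow> ('a \<Rightarrow> 'a \<Rightarrow> real) \<Rightarrow> 'b set \<Rightarrow> ('b \<Rightarrow> 'b \<Rightarrow> real) \<Rightarrow> ennreal" where
  "gromov_hausdorff X dX Y dY =
     Inf {ennreal \<epsilon> |\<epsilon>. 0 < \<epsilon> \<and>
            (\<exists>(Z :: ('a + 'b) set) dZ iX iY.
               quasi_metric Z dZ \<and>
               isometric_embedding X dX Z dZ iX \<and>
               isometric_embedding Y dY Z dZ iY \<and>
               hausdorff_Sym dZ (iX ` X) (iY ` Y) < ennreal \<epsilon>)}"

lemma ambient_in_sum_type:
  fixes X :: "'a set" and Y :: "'b set" and Z :: "'c set"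
  assumes X: "quasi_metric X dX" and Y: "quasi_metric Y dY" and Z: "quasi_metric Z dZ"
    and i: "isometric_embedding X dX Z dZ i" and j: "isometric_embedding Y dY Z dZ j"
  shows "\<exists>(W :: ('a + 'b) set) dW i' j'.
           quasi_metric W dW \<and>
           isometric_embedding X dX W dW i' \<and> isometric_embedding Y dY W dW j' \<and>
           hausdorff_Sym dW (i' ` X) (j' ` Y) = hausdorff_Sym dZ (i ` X) (j ` Y)"
proof -
  define g where "g = case_sum i j"
  define W where "W = Inl ` X \<union> Inr ` {y\<in>Y. j y \<notin> i ` X}"
  define dW where "dW u v = dZ (g u) (g v)" for u v
  define j' where "j' y = (if j y \<in> i ` X then Inl (inv_into X i (j y)) else Inr y)" for y
  have iZ: "i x \<in> Z" "dZ (i x) (i x') = dX x x'" if "x \<in> X" "x' \<in> X" for x x'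
    using i that by (auto simp: isometric_embedding_def)
  have jZ: "j y \<in> Z" "dZ (j y) (j y') = dY y y'" if "y \<in> Y" "y' \<in> Y" for y y'
    using j that by (auto simp: isometric_embedding_def)
  have i_inj: "x = x'" if "x \<in> X" "x' \<in> X" "i x = i x'" for x x'
  proof -
    have "dX x x' = dX x x" "dX x' x = dX x x"
      using iZ that by metis+
    moreover have "dX x x = 0" using X that by (auto simp: quasi_metric_def)
    ultimately show ?thesis using X that by (auto simp: quasi_metric_def)
  qed
  have j_inj: "y = y'" if "y \<in> Y" "y' \<in> Y" "j y = j y'" for y y'
  proof -
    have "dY y y' = dY y y" "dY y' y = dY y y"
      using jZ that by metis+
    moreover have "dY y y = 0" using Y that by (auto simp: quasi_metric_def)
    ultimately show ?thesis using Y that by (auto simp: quasi_metric_def)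
  qed
  have gW: "g u \<in> Z" if "u \<in> W" for u
    using that iZ jZ by (auto simp: W_def g_def)
  have g_inj: "u = v" if "u \<in> W" "v \<in> W" "g u = g v" for u v
    using that by (auto simp: W_def g_def intro: i_inj j_inj) (metis imageI)
  have gInl: "g (Inl x) = i x" for x by (simp add: g_def)
  have gj': "g (j' y) = j y" for y
    by (simp add: g_def j'_def f_inv_into_f)
  have j'W: "j' y \<in> W" if "y \<in> Y" for y
    using that by (auto simp: j'_def W_def inv_into_into)
  have "quasi_metric W dW"
    using Z gW g_inj unfolding quasi_metric_def dW_def by metis
  moreover have "isometric_embedding X dX W dW Inl"
    using iZ by (auto simp: isometric_embedding_def dW_def gInl W_def)
  moreover have "isometric_embedding Y dY W dW j'"
    using jZ j'W by (auto simp: isometric_embedding_def dW_def gj')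
  moreover have "hausdorff_Sym dW (Inl ` X) (j' ` Y) = hausdorff_Sym dZ (i ` X) (j ` Y)"
    by (simp add: hausdorff_Sym_def symmetrisation_def dW_def gInl gj')
  ultimately show ?thesis by blast
qed

lemma gromov_hausdorff_le:
  fixes X :: "'a set" and Y :: "'b set" and Z :: "'c set"
  assumes "quasi_metric X dX" "quasi_metric Y dY" "quasi_metric Z dZ"
    and "isometric_embedding X dX Z dZ i" "isometric_embedding Y dY Z dZ j"
    and "0 < \<epsilon>" "hausdorff_Sym dZ (i ` X) (j ` Y) < ennreal \<epsilon>"
  shows "gromov_hausdorff X dX Y dY \<le> ennreal \<epsilon>"
proof -
  obtain W :: "('a + 'b) set" and dW i' j' where
    "quasi_metric W dW" "isometric_embedding X dX W dW i'" "isometric_embedding Y dY W dW j'"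
    "hausdorff_Sym dW (i' ` X) (j' ` Y) = hausdorff_Sym dZ (i ` X) (j ` Y)"
    using ambient_in_sum_type[OF assms(1-5)] by blast
  then show ?thesis
    unfolding gromov_hausdorff_def using assms(6,7) by (intro Inf_lower) force
qed


section \<open>The q-hyperconvex hull\<close>

text \<open>Maps on \<open>X\<close> are represented by functions that are \<^term>\<open>undefined\<close> outside \<open>X\<close>,
  so that two elements agreeing on \<open>X\<close> are equal.\<close>

definition ample_pairs :: "'a set \<Rightarrow> ('a \<Rightarrow> 'a \<Rightarrow> real) \<Rightarrow> (('a \<Rightarrow> real) \<times> ('a \<Rightarrow> real)) set" where
  "ample_pairs X d =
     {(f1, f2). f1 \<in> X \<rightarrow>\<^sub>E {0..} \<and> f2 \<in> X \<rightarrow>\<^sub>E {0..} \<and>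
                (\<forall>x\<in>X. \<forall>y\<in>X. d x y \<le> f2 x + f1 y)}"

definition pair_le ::
    "'a set \<Rightarrow> ('a \<Rightarrow> real) \<times> ('a \<Rightarrow> real) \<Rightarrow> ('a \<Rightarrow> real) \<times> ('a \<Rightarrow> real) \<Rightarrow> bool" where
  "pair_le X f g \<longleftrightarrow> (\<forall>x\<in>X. fst f x \<le> fst g x) \<and> (\<forall>x\<in>X. snd f x \<le> snd g x)"

definition Q_hull :: "'a set \<Rightarrow> ('a \<Rightarrow> 'a \<Rightarrow> real) \<Rightarrow> (('a \<Rightarrow> real) \<times> ('a \<Rightarrow> real)) set" where
  "Q_hull X d = {f \<in> ample_pairs X d. \<forall>g \<in> ample_pairs X d. pair_le X g f \<longrightarrow> g = f}"

text \<open>The suprema are taken in \<open>[0, \<infinity>]\<close>, so that they are \<open>0\<close> for empty \<open>X\<close>.  They are finite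
  on \<^const>\<open>Q_hull\<close> (\<open>Q_dist_finite\<close>), so \<^const>\<open>enn2real\<close> loses nothing there.\<close>

definition Q_dist_ennreal ::
    "'a set \<Rightarrow> ('a \<Rightarrow> real) \<times> ('a \<Rightarrow> real) \<Rightarrow> ('a \<Rightarrow> real) \<times> ('a \<Rightarrow> real) \<Rightarrow> ennreal" where
  "Q_dist_ennreal X f g =
     max (SUP x\<in>X. ennreal (max (fst f x - fst g x) 0))
         (SUP x\<in>X. ennreal (max (snd g x - snd f x) 0))"

definition Q_dist ::
    "'a set \<Rightarrow> ('a \<Rightarrow> real) \<times> ('a \<Rightarrow> real) \<Rightarrow> ('a \<Rightarrow> real) \<times> ('a \<Rightarrow> real) \<Rightarrow> real" where
  "Q_dist X f g = enn2real (Q_dist_ennreal X f g)"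

lemma Q_dist_ennreal_le_iff:
  assumes "0 \<le> c"
  shows "Q_dist_ennreal X f g \<le> ennreal c \<longleftrightarrow>
           (\<forall>x\<in>X. fst f x - fst g x \<le> c \<and> snd g x - snd f x \<le> c)"
  using assms by (auto simp: Q_dist_ennreal_def SUP_le_iff ennreal_le_iff)

lemma Q_hull_lipschitz:
  assumes d: "quasi_metric X d" and f: "f \<in> Q_hull X d" and a: "a \<in> X" and b: "b \<in> X"
  shows "fst f a \<le> fst f b + d b a" "snd f a \<le> d a b + snd f b"
proof -
  obtain f1 f2 where f_eq: "f = (f1, f2)" by force
  have P: "f1 \<in> X \<rightarrow>\<^sub>E {0..}" "f2 \<in> X \<rightarrow>\<^sub>E {0..}" and
    le: "\<And>x y. x \<in> X \<Longrightarrow> y \<in> X \<Longrightarrow> d x y \<le> f2 x + f1 y"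
    and min: "\<And>g. g \<in> ample_pairs X d \<Longrightarrow> pair_le X g f \<Longrightarrow> g = f"
    using f by (auto simp: Q_hull_def ample_pairs_def f_eq)
  have nn: "0 \<le> d x y" and tri: "d x y \<le> d x z + d z y"
    if "x \<in> X" "y \<in> X" "z \<in> X" for x y z
    using d that by (auto simp: quasi_metric_def)
  have f_nn: "0 \<le> f1 x" "0 \<le> f2 x" if "x \<in> X" for x
    using P that by (auto simp: PiE_iff)
  show "fst f a \<le> fst f b + d b a"
  proof (rule ccontr)
    assume "\<not> ?thesis"
    then have lt: "f1 b + d b a < f1 a" by (simp add: f_eq)
    define g where "g = (f1(a := f1 b + d b a), f2)"
    have "d x a \<le> f2 x + (f1 b + d b a)" if "x \<in> X" for x
      using tri[OF that a b] le[OF that b] by linarith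
    moreover have "0 \<le> f1 b + d b a"
      using f_nn(1)[OF b] nn[OF b a b] by simp
    ultimately have "g \<in> ample_pairs X d"
      using P le a by (auto simp: g_def ample_pairs_def PiE_iff extensional_def)
    moreover have "pair_le X g f" using lt by (auto simp: pair_le_def g_def f_eq)
    ultimately have "g = f" by (rule min)
    then have "fst g a = f1 a" by (simp add: f_eq)
    then show False using lt by (simp add: g_def)
  qed
  show "snd f a \<le> d a b + snd f b"
  proof (rule ccontr)
    assume "\<not> ?thesis"
    then have lt: "d a b + f2 b < f2 a" by (simp add: f_eq)
    define g where "g = (f1, f2(a := d a b + f2 b))"
    have "d a x \<le> d a b + f2 b + f1 x" if "x \<in> X" for x
      using tri[OF a that b] le[OF b that] by linarith
    moreover have "0 \<le> d a b + f2 b"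
      using f_nn(2)[OF b] nn[OF a b b] by simp
    ultimately have "g \<in> ample_pairs X d"
      using P le a by (auto simp: g_def ample_pairs_def PiE_iff extensional_def)
    moreover have "pair_le X g f" using lt by (auto simp: pair_le_def g_def f_eq)
    ultimately have "g = f" by (rule min)
    then have "snd g a = f2 a" by (simp add: f_eq)
    then show False using lt by (simp add: g_def)
  qed
qed

lemma Q_dist_finite:
  assumes d: "quasi_metric X d" and f: "f \<in> Q_hull X d" and g: "g \<in> Q_hull X d"
  shows "Q_dist_ennreal X f g < \<infinity>"
proof (cases "X = {}")
  case True
  then show ?thesis by (simp add: Q_dist_ennreal_def bot_ennreal)
next
  case False
  then obtain b where b: "b \<in> X" by blast
  have nn: "0 \<le> fst f b" "0 \<le> snd g b"
    using f g b by (auto simp: Q_hull_def ample_pairs_def PiE_iff)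
  have g_le: "d x y \<le> snd g x + fst g y" if "x \<in> X" "y \<in> X" for x y
    using g that by (auto simp: Q_hull_def ample_pairs_def)
  have f_le: "d x y \<le> snd f x + fst f y" if "x \<in> X" "y \<in> X" for x y
    using f that by (auto simp: Q_hull_def ample_pairs_def)
  have "fst f x - fst g x \<le> fst f b + snd g b" if "x \<in> X" for x
    using Q_hull_lipschitz(1)[OF d f that b] g_le[OF b that] by linarith
  moreover have "snd g x - snd f x \<le> fst f b + snd g b" if "x \<in> X" for x
    using Q_hull_lipschitz(2)[OF d g that b] f_le[OF that b] by linarith
  ultimately have "Q_dist_ennreal X f g \<le> ennreal (fst f b + snd g b)"
    using nn by (subst Q_dist_ennreal_le_iff) auto
  then show ?thesis
    using le_less_trans by fastforce
qed

lemma Q_dist_le_iff: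
  assumes "quasi_metric X d" "f \<in> Q_hull X d" "g \<in> Q_hull X d" "0 \<le> c"
  shows "Q_dist X f g \<le> c \<longleftrightarrow>
           (\<forall>x\<in>X. fst f x - fst g x \<le> c \<and> snd g x - snd f x \<le> c)"
proof -
  have "Q_dist_ennreal X f g = ennreal (Q_dist X f g)"
    using Q_dist_finite[OF assms(1-3)] by (simp add: Q_dist_def)
  then have "Q_dist X f g \<le> c \<longleftrightarrow> Q_dist_ennreal X f g \<le> ennreal c"
    using assms(4) by (simp add: ennreal_le_iff)
  also have "\<dots> \<longleftrightarrow> (\<forall>x\<in>X. fst f x - fst g x \<le> c \<and> snd g x - snd f x \<le> c)"
    by (rule Q_dist_ennreal_le_iff[OF assms(4)])
  finally show ?thesis .
qed

lemma quasi_metric_Q_hull: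
  assumes d: "quasi_metric X d"
  shows "quasi_metric (Q_hull X d) (Q_dist X)"
proof -
  have nn: "0 \<le> Q_dist X f g" for f g by (simp add: Q_dist_def)
  have bd: "fst f x - fst g x \<le> Q_dist X f g \<and> snd g x - snd f x \<le> Q_dist X f g"
    if "f \<in> Q_hull X d" "g \<in> Q_hull X d" "x \<in> X" for f g x
    using Q_dist_le_iff[OF d that(1,2) nn, of f g] that(3) by blast
  have "Q_dist X f g \<le> Q_dist X f h + Q_dist X h g"
    if "f \<in> Q_hull X d" "g \<in> Q_hull X d" "h \<in> Q_hull X d" for f g h
  proof -
    have "\<forall>x\<in>X. fst f x - fst g x \<le> Q_dist X f h + Q_dist X h g \<and>
                snd g x - snd f x \<le> Q_dist X f h + Q_dist X h g"
      using bd[OF that(1,3)] bd[OF that(3,2)] by fastforce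
    then show ?thesis
      using Q_dist_le_iff[OF d that(1,2)] nn by (simp add: add_nonneg_nonneg)
  qed
  moreover have "Q_dist X f f = 0" if "f \<in> Q_hull X d" for f
    using Q_dist_le_iff[OF d that that, of 0] nn[of f f] by simp
  moreover have "f = g"
    if f: "f \<in> Q_hull X d" and g: "g \<in> Q_hull X d" and "Q_dist X f g = 0" "Q_dist X g f = 0" for f g
  proof -
    have "fst f x = fst g x \<and> snd f x = snd g x" if "x \<in> X" for x
      using bd[OF f g that] bd[OF g f that] \<open>Q_dist X f g = 0\<close> \<open>Q_dist X g f = 0\<close> by linarith
    moreover have "fst f \<in> extensional X" "snd f \<in> extensional X"
      "fst g \<in> extensional X" "snd g \<in> extensional X"
      using f g by (auto simp: Q_hull_def ample_pairs_def PiE_iff)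
    ultimately show ?thesis
      by (intro prod_eqI; intro extensionalityI[where A = X]; blast)
  qed
  ultimately show ?thesis
    unfolding quasi_metric_def using nn by blast
qed

end

theory Submission
  imports Defs
begin

text \<open>The argument passes through correspondences, relations between \<open>X\<close> and \<open>Y\<close> in which every
  point of either space has a partner.  If \<open>X\<close> and \<open>Y\<close> sit in a common space at Hausdorff distance
  less than \<open>\<epsilon>\<close>, then relating points at distance at most \<open>\<epsilon>\<close> distorts distances by at most
  \<open>2 * \<epsilon>\<close> (\<open>correspondence_of_hausdorff\<close>).  Conversely, along a correspondence with distortion
  \<open>2 * c\<close> the disjoint union can be made a space in which related points have distance \<open>c\<close>
  (\<open>gromov_hausdorff_le_of_correspondence\<close>).  So it suffices to see how a correspondence \<open>R\<close> with
  distortion \<open>2 * c\<close> acts on hulls.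

  Transporting \<open>(f1, f2) \<in> Q_hull X dX\<close> along \<open>R\<close> and adding \<open>c\<close> to both components compensates
  for the distortion and gives an ample pair on \<open>Y\<close>.  Below it lies a minimal pair \<open>(g1, g2)\<close>
  (\<open>Q_hull_below_ample_pair\<close>), and by construction \<open>g1 y \<le> f1 x + c\<close> and \<open>g2 y \<le> f2 x + c\<close>
  whenever \<open>x\<close> and \<open>y\<close> are related.  The reverse bounds follow from minimality: \<open>f1 x\<close> is no
  larger than the constraints \<open>dX x' x - f2 x' \<le> f1 x\<close> force it to be, and replacing \<open>x\<close>, \<open>x'\<close>, \<open>f2\<close>
  by their counterparts in \<open>Y\<close> lowers these bounds by at most \<open>2 * c + c\<close>;
  hence \<open>f1 x \<le> g1 y + 3 * c\<close> (\<open>Q_hull_fst_le_transfer\<close>).  So the pairs of hull elements that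
  differ by at most \<open>3 * c\<close> at related points form a correspondence, and its distortion is at most
  \<open>6 * c\<close>.  This proves the inequality with the constant \<open>3\<close> (\<open>gromov_hausdorff_Q_hull_le_3\<close>),
  which is stronger than the one with \<open>8\<close>.\<close>


section \<open>Correspondences\<close>

definition correspondence :: "'a set \<Rightarrow> 'b set \<Rightarrow> ('a \<times> 'b) set \<Rightarrow> bool" where
  "correspondence X Y R \<longleftrightarrow> Domain R = X \<and> Range R = Y"

definition distortion_le ::
    "('a \<Rightarrow> 'a \<Rightarrow> real) \<Rightarrow> ('b \<Rightarrow> 'b \<Rightarrow> real) \<Rightarrow> ('a \<times> 'b) set \<Rightarrow> real \<Rightarrow> bool" where
  "distortion_le dX dY R \<delta> \<longleftrightarrow>
     (\<forall>(x, y)\<in>R. \<forall>(x', y')\<in>R. \<bar>dX x x' - dY y y'\<bar> \<le> \<delta>)"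

lemma correspondenceD:
  assumes "correspondence X Y R"
  shows "(x, y) \<in> R \<Longrightarrow> x \<in> X" "(x, y) \<in> R \<Longrightarrow> y \<in> Y"
    and "x \<in> X \<Longrightarrow> \<exists>y. (x, y) \<in> R" "y \<in> Y \<Longrightarrow> \<exists>x. (x, y) \<in> R"
  using assms unfolding correspondence_def by blast+

lemma correspondence_converse: "correspondence X Y R \<Longrightarrow> correspondence Y X (R\<inverse>)"
  by (simp add: correspondence_def)

lemma distortion_leD:
  assumes "distortion_le dX dY R \<delta>" "(x, y) \<in> R" "(x', y') \<in> R"
  shows "dX x x' \<le> dY y y' + \<delta>" "dY y y' \<le> dX x x' + \<delta>"
proof -
  have "\<bar>dX x x' - dY y y'\<bar> \<le> \<delta>"
    using assms unfolding distortion_le_def by blast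
  then show "dX x x' \<le> dY y y' + \<delta>" "dY y y' \<le> dX x x' + \<delta>" by linarith+
qed

lemma distortion_le_converse: "distortion_le dX dY R \<delta> \<Longrightarrow> distortion_le dY dX (R\<inverse>) \<delta>"
  by (simp add: distortion_le_def abs_minus_commute split: prod.splits) blast

lemma quasi_metricD:
  assumes "quasi_metric X d"
  shows "x \<in> X \<Longrightarrow> y \<in> X \<Longrightarrow> 0 \<le> d x y"
    and "x \<in> X \<Longrightarrow> y \<in> X \<Longrightarrow> z \<in> X \<Longrightarrow> d x y \<le> d x z + d z y"
    and "x \<in> X \<Longrightarrow> d x x = 0"
    and "x \<in> X \<Longrightarrow> y \<in> X \<Longrightarrow> d x y = 0 \<Longrightarrow> d y x = 0 \<Longrightarrow> x = y"
  using assms unfolding quasi_metric_def by metis+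

text \<open>Relate points at symmetrised distance at most \<open>r\<close>, for some \<open>r < \<epsilon>\<close> that witnesses the
  Hausdorff distance.  Moving both arguments of a distance to related points costs \<open>r\<close> each.\<close>

lemma correspondence_of_hausdorff:
  assumes i: "isometric_embedding X dX Z dZ i" and j: "isometric_embedding Y dY Z dZ j"
    and Z: "quasi_metric Z dZ" and less: "hausdorff_Sym dZ (i ` X) (j ` Y) < ennreal \<epsilon>"
  shows "\<exists>R. correspondence X Y R \<and> distortion_le dX dY R (2 * \<epsilon>)"
proof -
  obtain r where r: "ennreal r < ennreal \<epsilon>" "0 \<le> r"
    and XY: "\<forall>a\<in>i ` X. \<exists>b\<in>j ` Y. symmetrisation dZ a b \<le> r"
    and YX: "\<forall>b\<in>j ` Y. \<exists>a\<in>i ` X. symmetrisation dZ a b \<le> r"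
    using less unfolding hausdorff_Sym_def Inf_less_iff by blast
  have r_less: "r < \<epsilon>" using r by (simp add: ennreal_less_iff)
  define R where "R = {(x, y). x \<in> X \<and> y \<in> Y \<and> symmetrisation dZ (i x) (j y) \<le> r}"
  have "correspondence X Y R"
    unfolding correspondence_def
  proof (intro conjI equalityI subsetI)
    show "x \<in> Domain R" if "x \<in> X" for x
      using XY that unfolding R_def by blast
    show "y \<in> Range R" if "y \<in> Y" for y
      using YX that unfolding R_def by blast
  qed (auto simp: R_def)
  moreover have "distortion_le dX dY R (2 * \<epsilon>)"
    unfolding distortion_le_def
  proof clarify
    fix x y x' y' assume R: "(x, y) \<in> R" "(x', y') \<in> R"
    have near: "dZ (i x) (j y) \<le> r" "dZ (j y) (i x) \<le> r"
      "dZ (i x') (j y') \<le> r" "dZ (j y') (i x') \<le> r"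
      using R by (simp_all add: R_def symmetrisation_def)
    have mem: "i x \<in> Z" "i x' \<in> Z" "j y \<in> Z" "j y' \<in> Z"
      and iso: "dX x x' = dZ (i x) (i x')" "dY y y' = dZ (j y) (j y')"
      using R i j by (auto simp: R_def isometric_embedding_def)
    note tri = quasi_metricD(2)[OF Z]
    have "dZ (i x) (i x') \<le> dZ (i x) (j y) + dZ (j y) (j y') + dZ (j y') (i x')"
      using tri[of "i x" "i x'" "j y"] tri[of "j y" "i x'" "j y'"] mem by linarith
    moreover have "dZ (j y) (j y') \<le> dZ (j y) (i x) + dZ (i x) (i x') + dZ (i x') (j y')"
      using tri[of "j y" "j y'" "i x"] tri[of "i x" "j y'" "i x'"] mem by linarith
    ultimately show "\<bar>dX x x' - dY y y'\<bar> \<le> 2 * \<epsilon>"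
      using near iso r_less by linarith
  qed
  ultimately show ?thesis by blast
qed


section \<open>Gluing two spaces along a correspondence\<close>

text \<open>The infimum of the lengths of routes from \<open>x \<in> X\<close> to \<open>y \<in> Y\<close> that cross over once, between
  related points, at the price \<open>c\<close>.\<close>

definition cross_dist ::
    "('a \<times> 'b) set \<Rightarrow> real \<Rightarrow> ('a \<Rightarrow> 'a \<Rightarrow> real) \<Rightarrow> ('b \<Rightarrow> 'b \<Rightarrow> real) \<Rightarrow> 'a \<Rightarrow> 'b \<Rightarrow> real" where
  "cross_dist R c dX dY x y = (INF (a, b)\<in>R. dX x a + c + dY b y)"

text \<open>Distances from \<open>Y\<close> to \<open>X\<close> are those for the converse relation, so that facts about
  \<^const>\<open>cross_dist\<close> are needed in one direction only.\<close>

fun glued_dist ::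
    "('a \<times> 'b) set \<Rightarrow> real \<Rightarrow> ('a \<Rightarrow> 'a \<Rightarrow> real) \<Rightarrow> ('b \<Rightarrow> 'b \<Rightarrow> real) \<Rightarrow> 'a + 'b \<Rightarrow> 'a + 'b \<Rightarrow> real"
  where
    "glued_dist R c dX dY (Inl x) (Inl x') = dX x x'"
  | "glued_dist R c dX dY (Inr y) (Inr y') = dY y y'"
  | "glued_dist R c dX dY (Inl x) (Inr y) = cross_dist R c dX dY x y"
  | "glued_dist R c dX dY (Inr y) (Inl x) = cross_dist (R\<inverse>) c dY dX y x"

context
  fixes X :: "'a set" and dX and Y :: "'b set" and dY and R and c :: real
  assumes X: "quasi_metric X dX" and Y: "quasi_metric Y dY"
    and R: "correspondence X Y R"
begin

lemma cross_summand_ge: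
  assumes "x \<in> X" "y \<in> Y" "(a, b) \<in> R"
  shows "c \<le> dX x a + c + dY b y"
  using quasi_metricD(1)[OF X assms(1) correspondenceD(1)[OF R assms(3)]]
    quasi_metricD(1)[OF Y correspondenceD(2)[OF R assms(3)] assms(2)] by simp

lemma cross_dist_le:
  assumes "x \<in> X" "y \<in> Y" "(a, b) \<in> R"
  shows "cross_dist R c dX dY x y \<le> dX x a + c + dY b y"
proof -
  have "bdd_below ((\<lambda>(a, b). dX x a + c + dY b y) ` R)"
    using cross_summand_ge[OF assms(1,2)] by (intro bdd_belowI2[where m = c]) auto
  from cINF_lower[OF this assms(3)] show ?thesis by (simp add: cross_dist_def)
qed

lemma cross_dist_greatest:
  assumes "x \<in> X" "\<And>a b. (a, b) \<in> R \<Longrightarrow> m \<le> dX x a + c + dY b y"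
  shows "m \<le> cross_dist R c dX dY x y"
  unfolding cross_dist_def
  using correspondenceD(3)[OF R assms(1)] assms(2) by (intro cINF_greatest) auto

lemma cross_dist_ge:
  assumes "x \<in> X" "y \<in> Y"
  shows "c \<le> cross_dist R c dX dY x y"
  using cross_summand_ge assms by (intro cross_dist_greatest) auto

lemma cross_dist_le_related:
  assumes "(x, y) \<in> R"
  shows "cross_dist R c dX dY x y \<le> c"
  using cross_dist_le[of x y x y] correspondenceD(1,2)[OF R assms] assms
    quasi_metricD(3)[OF X] quasi_metricD(3)[OF Y] by simp

lemma cross_dist_triangle_left:
  assumes x: "x \<in> X" and x': "x' \<in> X" and y: "y \<in> Y"
  shows "cross_dist R c dX dY x y \<le> dX x x' + cross_dist R c dX dY x' y"
proof -
  have "cross_dist R c dX dY x y - dX x x' \<le> dX x' a + c + dY b y" if ab: "(a, b) \<in> R" for a b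
    using cross_dist_le[OF x y ab] quasi_metricD(2)[OF X x _ x', of a] correspondenceD(1)[OF R ab]
    by linarith
  from cross_dist_greatest[OF x' this] show ?thesis by linarith
qed

lemma cross_dist_triangle_right:
  assumes x: "x \<in> X" and y: "y \<in> Y" and y': "y' \<in> Y"
  shows "cross_dist R c dX dY x y \<le> cross_dist R c dX dY x y' + dY y' y"
proof -
  have "cross_dist R c dX dY x y - dY y' y \<le> dX x a + c + dY b y'" if ab: "(a, b) \<in> R" for a b
    using cross_dist_le[OF x y ab] quasi_metricD(2)[OF Y _ y y', of b] correspondenceD(2)[OF R ab]
    by linarith
  from cross_dist_greatest[OF x this] show ?thesis by linarith
qed

end

text \<open>The bound on the distortion enters here: crossing over and coming back costs
  \<open>2 * c\<close>, which pays for what may be gained by travelling between the two crossing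
  points inside \<open>Y\<close>.\<close>

lemma cross_dist_triangle_across:
  assumes X: "quasi_metric X dX" and Y: "quasi_metric Y dY"
    and R: "correspondence X Y R" and dist: "distortion_le dX dY R (2 * c)"
    and x: "x \<in> X" and x': "x' \<in> X" and y: "y \<in> Y"
  shows "dX x x' \<le> cross_dist R c dX dY x y + cross_dist (R\<inverse>) c dY dX y x'"
proof -
  have "dX x x' \<le> (dX x a + c + dY b y) + (dY y b' + c + dX a' x')"
    if ab: "(a, b) \<in> R" and ab': "(a', b') \<in> R" for a b a' b'
  proof -
    note mem = correspondenceD(1,2)[OF R ab] correspondenceD(1,2)[OF R ab']
    have "dX x x' \<le> dX x a + dX a a' + dX a' x'"
      using quasi_metricD(2)[OF X, of x x' a] quasi_metricD(2)[OF X, of a x' a'] x x' mem by linarith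
    moreover have "dX a a' \<le> dY b b' + 2 * c"
      by (rule distortion_leD(1)[OF dist ab ab'])
    moreover have "dY b b' \<le> dY b y + dY y b'"
      using quasi_metricD(2)[OF Y, of b b' y] y mem by blast
    ultimately show ?thesis by linarith
  qed
  then have "dX x x' - (dX x a + c + dY b y) \<le> cross_dist (R\<inverse>) c dY dX y x'"
    if "(a, b) \<in> R" for a b
    using that
    by (intro cross_dist_greatest[OF Y X correspondence_converse[OF R] y])
      (force simp: algebra_simps)
  then have "dX x x' - cross_dist (R\<inverse>) c dY dX y x' \<le> cross_dist R c dX dY x y"
    by (intro cross_dist_greatest[OF X Y R x]) (force simp: algebra_simps)
  then show ?thesis by linarith
qed

lemma quasi_metric_glued:
  assumes X: "quasi_metric X dX" and Y: "quasi_metric Y dY"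
    and R: "correspondence X Y R" and dist: "distortion_le dX dY R (2 * c)" and c: "0 < c"
  shows "quasi_metric (Inl ` X \<union> Inr ` Y) (glued_dist R c dX dY)"
proof -
  note R' = correspondence_converse[OF R] and dist' = distortion_le_converse[OF dist]
  note 1 = X Y R and 2 = Y X R'
  have pos: "0 < cross_dist R c dX dY x y" "0 < cross_dist (R\<inverse>) c dY dX y x"
    if "x \<in> X" "y \<in> Y" for x y
    using cross_dist_ge[OF 1 that, of c] cross_dist_ge[OF 2 that(2,1), of c] c by linarith+
  have across: "dY y y' \<le> cross_dist (R\<inverse>) c dY dX y x + cross_dist R c dX dY x y'"
    if "x \<in> X" "y \<in> Y" "y' \<in> Y" for x y y'
    using cross_dist_triangle_across[OF 2 dist' that(2,3,1)] by simp
  let ?W = "Inl ` X \<union> Inr ` Y" and ?d = "glued_dist R c dX dY"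
  show ?thesis
    unfolding quasi_metric_def
  proof (intro conjI ballI)
    fix u v assume uv: "u \<in> ?W" "v \<in> ?W"
    show "0 \<le> ?d u v"
      using uv pos quasi_metricD(1)[OF X] quasi_metricD(1)[OF Y] by (auto intro: less_imp_le)
    show "(?d u v = 0 \<and> ?d v u = 0) \<longleftrightarrow> u = v"
      using uv pos quasi_metricD(3,4)[OF X] quasi_metricD(3,4)[OF Y] by force
    fix w assume w: "w \<in> ?W"
    show "?d u v \<le> ?d u w + ?d w v"
      using uv w
      by (auto intro: quasi_metricD(2)[OF X] quasi_metricD(2)[OF Y] across
          cross_dist_triangle_across[OF 1 dist] cross_dist_triangle_left[OF 1]
          cross_dist_triangle_right[OF 1] cross_dist_triangle_left[OF 2]
          cross_dist_triangle_right[OF 2])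
  qed
qed

lemma gromov_hausdorff_le_of_correspondence:
  assumes X: "quasi_metric X dX" and Y: "quasi_metric Y dY"
    and R: "correspondence X Y R" and dist: "distortion_le dX dY R (2 * c)" and c: "0 < c"
  shows "gromov_hausdorff X dX Y dY \<le> ennreal c"
proof (rule ennreal_le_epsilon)
  fix e :: real assume e: "0 < e"
  note R' = correspondence_converse[OF R]
  let ?d = "glued_dist R c dX dY"
  have near: "symmetrisation ?d (Inl x) (Inr y) \<le> c" if "(x, y) \<in> R" for x y
    using cross_dist_le_related[OF X Y R that] cross_dist_le_related[OF Y X R'] that
    by (simp add: symmetrisation_def)
  have "hausdorff_Sym ?d (Inl ` X) (Inr ` Y) \<le> ennreal c"
    unfolding hausdorff_Sym_def
  proof (rule Inf_lower, rule CollectI, rule exI[of _ c], intro conjI)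
    show "\<forall>a\<in>Inl ` X. \<exists>b\<in>Inr ` Y. symmetrisation ?d a b \<le> c"
      using near correspondenceD(3)[OF R] correspondenceD(2)[OF R] by fast
    show "\<forall>b\<in>Inr ` Y. \<exists>a\<in>Inl ` X. symmetrisation ?d a b \<le> c"
      using near correspondenceD(4)[OF R] correspondenceD(1)[OF R] by fast
  qed (use c in simp_all)
  also have "\<dots> < ennreal (c + e)"
    using c e by (simp add: ennreal_less_iff)
  finally have "gromov_hausdorff X dX Y dY \<le> ennreal (c + e)"
    using c e
    by (intro gromov_hausdorff_le[OF X Y quasi_metric_glued[OF X Y R dist c]])
      (auto simp: isometric_embedding_def)
  then show "gromov_hausdorff X dX Y dY \<le> ennreal c + ennreal e"
    using c e by simp
qed


section \<open>Minimal pairs\<close>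

lemma ample_pairsD:
  assumes "(f1, f2) \<in> ample_pairs X d"
  shows "f1 \<in> extensional X" "f2 \<in> extensional X"
    and "x \<in> X \<Longrightarrow> 0 \<le> f1 x" "x \<in> X \<Longrightarrow> 0 \<le> f2 x"
    and "x \<in> X \<Longrightarrow> y \<in> X \<Longrightarrow> d x y \<le> f2 x + f1 y"
  using assms by (auto simp: ample_pairs_def PiE_iff)

text \<open>Reversing all distances exchanges the two components of a pair, which reduces statements about
  second components to statements about first components.\<close>

lemma ample_pairs_swap:
  "(f2, f1) \<in> ample_pairs X (\<lambda>x y. d y x) \<longleftrightarrow> (f1, f2) \<in> ample_pairs X d"
  by (auto simp: ample_pairs_def add.commute)

lemma Q_hull_iff:
  "(f1, f2) \<in> Q_hull X d \<longleftrightarrow> (f1, f2) \<in> ample_pairs X d \<and>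
     (\<forall>g1 g2. (g1, g2) \<in> ample_pairs X d \<longrightarrow> (\<forall>x\<in>X. g1 x \<le> f1 x \<and> g2 x \<le> f2 x) \<longrightarrow>
        g1 = f1 \<and> g2 = f2)"
  by (simp add: Q_hull_def pair_le_def Ball_def) blast

lemma Q_hull_swap:
  "(f2, f1) \<in> Q_hull X (\<lambda>x y. d y x) \<longleftrightarrow> (f1, f2) \<in> Q_hull X d"
  \<comment> \<open>Fixing \<open>d\<close> matters: the right-hand side of the rule is itself an instance of its left-hand side.\<close>
  unfolding Q_hull_iff ample_pairs_swap[of _ _ X d] by blast

text \<open>If \<open>f1 x\<close> were larger, it could be lowered to \<open>c\<close> without violating ampleness, against
  minimality.  Thus \<open>f1 x\<close> is the least nonnegative value permitted by \<open>f2\<close>.\<close>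

lemma Q_hull_fst_le:
  assumes f: "(f1, f2) \<in> Q_hull X d" and x: "x \<in> X" and c: "0 \<le> c"
    and le: "\<And>x'. x' \<in> X \<Longrightarrow> d x' x \<le> f2 x' + c"
  shows "f1 x \<le> c"
proof (rule ccontr)
  assume less: "\<not> f1 x \<le> c"
  have "(f1, f2) \<in> ample_pairs X d" using f by (simp add: Q_hull_iff)
  then have "(f1(x := c), f2) \<in> ample_pairs X d"
    using c le x by (auto simp: ample_pairs_def PiE_iff extensional_def)
  moreover have "\<forall>x'\<in>X. (f1(x := c)) x' \<le> f1 x' \<and> f2 x' \<le> f2 x'"
    using less by simp
  ultimately have "f1(x := c) = f1" using f unfolding Q_hull_iff by blast
  then have "f1 x = c" by (metis fun_upd_same)
  then show False using less by simp
qed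

text \<open>For a second component \<open>h\<close> of an ample pair, this is the least function that completes \<open>h\<close>
  to an ample pair.  The maximum with \<open>0\<close> enforces nonnegativity; the supremum is over a nonempty
  set, as \<open>y\<close> itself lies in \<open>X\<close>.\<close>

definition conjugate :: "'a set \<Rightarrow> ('a \<Rightarrow> 'a \<Rightarrow> real) \<Rightarrow> ('a \<Rightarrow> real) \<Rightarrow> 'a \<Rightarrow> real" where
  "conjugate X d h = (\<lambda>y\<in>X. SUP x\<in>X. max (d x y - h x) 0)"

lemma conjugate_least:
  assumes "y \<in> X" "0 \<le> c" "\<And>x. x \<in> X \<Longrightarrow> d x y \<le> h x + c"
  shows "conjugate X d h y \<le> c"
proof -
  have "(SUP x\<in>X. max (d x y - h x) 0) \<le> c"
    using assms by (intro cSUP_least) (auto simp: algebra_simps)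
  then show ?thesis using assms(1) by (simp add: conjugate_def)
qed

lemma ample_pairs_conjugate:
  assumes f: "(f1, f2) \<in> ample_pairs X d"
  shows "(conjugate X d f2, f2) \<in> ample_pairs X d"
proof -
  have upper: "max (d x y - f2 x) 0 \<le> conjugate X d f2 y" if "x \<in> X" "y \<in> X" for x y
  proof -
    have "bdd_above ((\<lambda>x. max (d x y - f2 x) 0) ` X)"
      using ample_pairsD(3,5)[OF f] that(2)
      by (intro bdd_aboveI2[where M = "f1 y"]) (auto simp: algebra_simps)
    from cSUP_upper[OF that(1) this] show ?thesis using that(2) by (simp add: conjugate_def)
  qed
  have "0 \<le> conjugate X d f2 y" if "y \<in> X" for y
    using upper[OF that that] by simp
  moreover have "d x y \<le> f2 x + conjugate X d f2 y" if "x \<in> X" "y \<in> X" for x y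
    using upper[OF that] by simp
  moreover have "conjugate X d f2 \<in> extensional X" by (simp add: conjugate_def)
  ultimately show ?thesis
    using ample_pairsD(2,4)[OF f] by (auto simp: ample_pairs_def PiE_iff)
qed

text \<open>Two conjugations suffice: first \<open>f1\<close> is replaced by the conjugate \<open>g1\<close> of \<open>f2\<close>, then \<open>f2\<close> by the
  conjugate \<open>g2\<close> of \<open>g1\<close> for the reversed distances.  An ample pair \<open>(h1, h2)\<close> below \<open>(g1, g2)\<close> has
  \<open>h2 \<le> g2 \<le> f2\<close>, so \<open>h1\<close> completes \<open>f2\<close> to an ample pair and thus \<open>g1 \<le> h1\<close>; likewise
  \<open>g2 \<le> h2\<close>.\<close>

lemma Q_hull_below_ample_pair:
  assumes f: "(f1, f2) \<in> ample_pairs X d"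
  obtains g1 g2 where "(g1, g2) \<in> Q_hull X d"
    and "\<And>x. x \<in> X \<Longrightarrow> g1 x \<le> f1 x" "\<And>x. x \<in> X \<Longrightarrow> g2 x \<le> f2 x"
proof
  define g1 where "g1 = conjugate X d f2"
  define g2 where "g2 = conjugate X (\<lambda>x y. d y x) g1"
  have amp: "(g1, f2) \<in> ample_pairs X d"
    unfolding g1_def by (rule ample_pairs_conjugate[OF f])
  have g: "(g1, g2) \<in> ample_pairs X d"
    unfolding g2_def using ample_pairs_conjugate amp by (metis ample_pairs_swap)
  show f1: "g1 x \<le> f1 x" if "x \<in> X" for x
    unfolding g1_def using ample_pairsD(3,5)[OF f] that by (intro conjugate_least) auto
  show f2: "g2 x \<le> f2 x" if "x \<in> X" for x
    unfolding g2_def using ample_pairsD(4,5)[OF amp] that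
    by (intro conjugate_least) (auto simp: add.commute)
  have "h1 = g1 \<and> h2 = g2"
    if h: "(h1, h2) \<in> ample_pairs X d" and le: "\<forall>x\<in>X. h1 x \<le> g1 x \<and> h2 x \<le> g2 x" for h1 h2
  proof -
    have le1: "h1 x \<le> g1 x" and le2: "h2 x \<le> g2 x" if "x \<in> X" for x
      using le that by auto
    have "g1 y \<le> h1 y" if "y \<in> X" for y
    proof -
      have "d x y \<le> f2 x + h1 y" if "x \<in> X" for x
        using ample_pairsD(5)[OF h that \<open>y \<in> X\<close>] le2[OF that] f2[OF that] by linarith
      then show ?thesis
        unfolding g1_def using ample_pairsD(3)[OF h] that by (intro conjugate_least) auto
    qed
    moreover have "g2 x \<le> h2 x" if "x \<in> X" for x
    proof -
      have "d x y \<le> g1 y + h2 x" if "y \<in> X" for y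
        using ample_pairsD(5)[OF h \<open>x \<in> X\<close> that] le1[OF that] by linarith
      then show ?thesis
        unfolding g2_def using ample_pairsD(4)[OF h] that by (intro conjugate_least) auto
    qed
    ultimately have "h1 x = g1 x" "h2 x = g2 x" if "x \<in> X" for x
      using le1 le2 that by (auto intro: antisym)
    then show ?thesis
      using ample_pairsD(1,2)[OF h] ample_pairsD(1,2)[OF g] by (auto intro: extensionalityI)
  qed
  then show "(g1, g2) \<in> Q_hull X d"
    using g unfolding Q_hull_iff by blast
qed


section \<open>The hulls of spaces in correspondence\<close>

definition hull_correspondence ::
    "'a set \<Rightarrow> ('a \<Rightarrow> 'a \<Rightarrow> real) \<Rightarrow> 'b set \<Rightarrow> ('b \<Rightarrow> 'b \<Rightarrow> real) \<Rightarrow> ('a \<times> 'b) set \<Rightarrow> real \<Rightarrow>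
     ((('a \<Rightarrow> real) \<times> ('a \<Rightarrow> real)) \<times> (('b \<Rightarrow> real) \<times> ('b \<Rightarrow> real))) set" where
  "hull_correspondence X dX Y dY R c =
     {(f, g). f \<in> Q_hull X dX \<and> g \<in> Q_hull Y dY \<and>
        (\<forall>(x, y)\<in>R. \<bar>fst f x - fst g y\<bar> \<le> c \<and> \<bar>snd f x - snd g y\<bar> \<le> c)}"

lemma hull_correspondence_converse:
  "(hull_correspondence X dX Y dY R c)\<inverse> = hull_correspondence Y dY X dX (R\<inverse>) c"
  by (auto simp: hull_correspondence_def abs_minus_commute)

text \<open>Each constraint \<open>dX x' x \<le> f2 x' + f1 x\<close> has a counterpart in \<open>Y\<close>.  Passing to it changes the
  distance by at most \<open>2 * c\<close> and, by the one-sided bound on \<open>g2\<close>, costs another \<open>c\<close>; so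
  \<open>g1 y + 3 * c\<close> satisfies all constraints on \<open>f1 x\<close>.\<close>

lemma Q_hull_fst_le_transfer:
  assumes R: "correspondence X Y R" and dist: "distortion_le dX dY R (2 * c)" and c: "0 \<le> c"
    and f: "(f1, f2) \<in> Q_hull X dX" and g: "(g1, g2) \<in> Q_hull Y dY" and xy: "(x, y) \<in> R"
    and g2: "\<And>x y. (x, y) \<in> R \<Longrightarrow> g2 y \<le> f2 x + c"
  shows "f1 x \<le> g1 y + 3 * c"
proof (rule Q_hull_fst_le[OF f correspondenceD(1)[OF R xy]])
  have g_amp: "(g1, g2) \<in> ample_pairs Y dY" using g by (simp add: Q_hull_iff)
  note y = correspondenceD(2)[OF R xy]
  show "0 \<le> g1 y + 3 * c" using ample_pairsD(3)[OF g_amp y] c by simp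
  fix x' assume "x' \<in> X"
  then obtain y' where xy': "(x', y') \<in> R" using correspondenceD(3)[OF R] by blast
  have "dX x' x \<le> dY y' y + 2 * c" by (rule distortion_leD(1)[OF dist xy' xy])
  also have "dY y' y \<le> g2 y' + g1 y"
    by (rule ample_pairsD(5)[OF g_amp correspondenceD(2)[OF R xy'] y])
  also have "g2 y' \<le> f2 x' + c" by (rule g2[OF xy'])
  finally show "dX x' x \<le> f2 x' + (g1 y + 3 * c)" by simp
qed

text \<open>The partner of \<open>f\<close> is a minimal pair below the pair obtained from \<open>f\<close> by transport along \<open>R\<close>.
  A point \<open>y\<close> may be related to many points \<open>x\<close>; taking the infimum over them
  makes the upper bound hold at all of them.\<close>

lemma hull_correspondence_total:
  assumes R: "correspondence X Y R" and dist: "distortion_le dX dY R (2 * c)" and c: "0 \<le> c"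
    and f: "f \<in> Q_hull X dX"
  shows "\<exists>g. (f, g) \<in> hull_correspondence X dX Y dY R (3 * c)"
proof -
  obtain f1 f2 where f_eq: "f = (f1, f2)" by force
  have amp: "(f1, f2) \<in> ample_pairs X dX" using f by (simp add: f_eq Q_hull_iff)
  define h where "h k = (\<lambda>y\<in>Y. (INF x\<in>{x. (x, y) \<in> R}. k x) + c)" for k :: "'a \<Rightarrow> real"
  have h_le: "h k y \<le> k x + c" if "\<And>x. x \<in> X \<Longrightarrow> 0 \<le> k x" "(x, y) \<in> R" for k x y
  proof -
    have "bdd_below (k ` {x. (x, y) \<in> R})"
      using that(1) correspondenceD(1)[OF R] by (intro bdd_belowI2[where m = 0]) auto
    from cINF_lower[OF this, of x] show ?thesis
      using that(2) correspondenceD(2)[OF R that(2)] by (simp add: h_def)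
  qed
  have h_greatest: "m \<le> h k y"
    if y: "y \<in> Y" and le: "\<And>x. (x, y) \<in> R \<Longrightarrow> m \<le> k x + c" for k y m
  proof -
    have "m - c \<le> (INF x\<in>{x. (x, y) \<in> R}. k x)"
      using correspondenceD(4)[OF R y] le by (intro cINF_greatest) (auto simp: algebra_simps)
    then show ?thesis using y by (simp add: h_def)
  qed
  have h_nonneg: "0 \<le> h k y" if "\<And>x. x \<in> X \<Longrightarrow> 0 \<le> k x" "y \<in> Y" for k y
    using that c correspondenceD(1)[OF R] by (intro h_greatest) auto
  have h_amp: "dY y y' \<le> h f2 y + h f1 y'" if y: "y \<in> Y" and y': "y' \<in> Y" for y y'
  proof -
    have "dY y y' - (f2 x + c) \<le> f1 x' + c" if xy: "(x, y) \<in> R" and xy': "(x', y') \<in> R" for x x'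
      using distortion_leD(2)[OF dist xy xy']
        ample_pairsD(5)[OF amp correspondenceD(1)[OF R xy] correspondenceD(1)[OF R xy']]
      by linarith
    then have "dY y y' - (f2 x + c) \<le> h f1 y'" if "(x, y) \<in> R" for x
      using that by (intro h_greatest[OF y'])
    then have "dY y y' - h f1 y' \<le> h f2 y"
      by (intro h_greatest[OF y]) (force simp: algebra_simps)
    then show ?thesis by linarith
  qed
  have ext: "h k \<in> extensional Y" for k by (simp add: h_def)
  have "(h f1, h f2) \<in> ample_pairs Y dY"
    using h_nonneg[OF ample_pairsD(3)[OF amp]] h_nonneg[OF ample_pairsD(4)[OF amp]] h_amp ext
    by (auto simp: ample_pairs_def PiE_iff)
  then obtain g1 g2 where g: "(g1, g2) \<in> Q_hull Y dY"
    and g_le: "\<And>y. y \<in> Y \<Longrightarrow> g1 y \<le> h f1 y" "\<And>y. y \<in> Y \<Longrightarrow> g2 y \<le> h f2 y"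
    by (rule Q_hull_below_ample_pair) blast
  have up1: "g1 y \<le> f1 x + c" if "(x, y) \<in> R" for x y
    using g_le(1)[OF correspondenceD(2)[OF R that]] h_le[where k = f1, OF ample_pairsD(3)[OF amp] that] by linarith
  have up2: "g2 y \<le> f2 x + c" if "(x, y) \<in> R" for x y
    using g_le(2)[OF correspondenceD(2)[OF R that]] h_le[where k = f2, OF ample_pairsD(4)[OF amp] that] by linarith
  have low1: "f1 x \<le> g1 y + 3 * c" if "(x, y) \<in> R" for x y
    using Q_hull_fst_le_transfer[OF R dist c] f g up2 that unfolding f_eq by blast
  \<comment> \<open>The second components are the first ones of the hulls for the reversed distances.\<close>
  have dist': "distortion_le (\<lambda>x y. dX y x) (\<lambda>x y. dY y x) R (2 * c)"
    using dist by (auto simp: distortion_le_def)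
  have low2: "f2 x \<le> g2 y + 3 * c" if "(x, y) \<in> R" for x y
    using Q_hull_fst_le_transfer[OF R dist' c, of f2 f1 g2 g1] f g up1 that
    unfolding f_eq by (simp add: Q_hull_swap[of _ _ X dX] Q_hull_swap[of _ _ Y dY])
  have "\<bar>f1 x - g1 y\<bar> \<le> 3 * c \<and> \<bar>f2 x - g2 y\<bar> \<le> 3 * c" if "(x, y) \<in> R" for x y
    using up1[OF that] up2[OF that] low1[OF that] low2[OF that] c by linarith
  then have "(f, (g1, g2)) \<in> hull_correspondence X dX Y dY R (3 * c)"
    using f g by (auto simp: hull_correspondence_def f_eq)
  then show ?thesis ..
qed

lemma correspondence_hull_correspondence:
  assumes R: "correspondence X Y R" and dist: "distortion_le dX dY R (2 * c)" and c: "0 \<le> c"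
  shows "correspondence (Q_hull X dX) (Q_hull Y dY) (hull_correspondence X dX Y dY R (3 * c))"
proof -
  let ?H = "hull_correspondence X dX Y dY R (3 * c)"
  have "\<exists>g. (f, g) \<in> ?H" if "f \<in> Q_hull X dX" for f
    using hull_correspondence_total[OF R dist c that] .
  moreover have "\<exists>f. (f, g) \<in> ?H" if "g \<in> Q_hull Y dY" for g
    using hull_correspondence_total[OF correspondence_converse[OF R] distortion_le_converse[OF dist] c that]
    by (simp flip: hull_correspondence_converse)
  moreover have "?H \<subseteq> Q_hull X dX \<times> Q_hull Y dY"
    by (auto simp: hull_correspondence_def)
  ultimately show ?thesis unfolding correspondence_def by blast
qed

text \<open>The distances on hulls are suprema of differences of values, and each of the two values in such
  a difference changes by at most \<open>c\<close>.\<close>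

lemma Q_dist_le_of_hull_correspondence:
  assumes X: "quasi_metric X dX" and Y: "quasi_metric Y dY" and R: "correspondence X Y R"
    and c: "0 \<le> c" and fg: "(f, g) \<in> hull_correspondence X dX Y dY R c"
    and fg': "(f', g') \<in> hull_correspondence X dX Y dY R c"
  shows "Q_dist X f f' \<le> Q_dist Y g g' + 2 * c"
proof -
  have f: "f \<in> Q_hull X dX" "f' \<in> Q_hull X dX" and g: "g \<in> Q_hull Y dY" "g' \<in> Q_hull Y dY"
    using fg fg' by (auto simp: hull_correspondence_def)
  have nn: "0 \<le> Q_dist Y g g'" by (simp add: Q_dist_def)
  have "fst f x - fst f' x \<le> Q_dist Y g g' + 2 * c \<and> snd f' x - snd f x \<le> Q_dist Y g g' + 2 * c"
    if x: "x \<in> X" for x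
  proof -
    obtain y where xy: "(x, y) \<in> R" using correspondenceD(3)[OF R x] by blast
    have "fst g y - fst g' y \<le> Q_dist Y g g'" "snd g' y - snd g y \<le> Q_dist Y g g'"
      using Q_dist_le_iff[OF Y g nn] correspondenceD(2)[OF R xy] by auto
    moreover have "\<bar>fst f x - fst g y\<bar> \<le> c" "\<bar>snd f x - snd g y\<bar> \<le> c"
      "\<bar>fst f' x - fst g' y\<bar> \<le> c" "\<bar>snd f' x - snd g' y\<bar> \<le> c"
      using fg fg' xy by (auto simp: hull_correspondence_def)
    ultimately show ?thesis by linarith
  qed
  then show ?thesis
    using nn c by (subst Q_dist_le_iff[OF X f]) auto
qed

lemma distortion_le_hull_correspondence:
  assumes X: "quasi_metric X dX" and Y: "quasi_metric Y dY" and R: "correspondence X Y R"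
    and c: "0 \<le> c"
  shows "distortion_le (Q_dist X) (Q_dist Y) (hull_correspondence X dX Y dY R c) (2 * c)"
  unfolding distortion_le_def
proof (intro ballI, clarify)
  fix f g f' g'
  assume fg: "(f, g) \<in> hull_correspondence X dX Y dY R c"
    and fg': "(f', g') \<in> hull_correspondence X dX Y dY R c"
  have "Q_dist X f f' \<le> Q_dist Y g g' + 2 * c"
    by (rule Q_dist_le_of_hull_correspondence[OF X Y R c fg fg'])
  moreover have "Q_dist Y g g' \<le> Q_dist X f f' + 2 * c"
    using fg fg' by (intro Q_dist_le_of_hull_correspondence[OF Y X correspondence_converse[OF R] c])
      (simp_all flip: hull_correspondence_converse)
  ultimately show "\<bar>Q_dist X f f' - Q_dist Y g g'\<bar> \<le> 2 * c" by linarith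
qed

theorem gromov_hausdorff_Q_hull_le_3:
  assumes X: "quasi_metric X dX" and Y: "quasi_metric Y dY"
  shows "gromov_hausdorff (Q_hull X dX) (Q_dist X) (Q_hull Y dY) (Q_dist Y)
           \<le> 3 * gromov_hausdorff X dX Y dY"
proof -
  let ?G = "gromov_hausdorff (Q_hull X dX) (Q_dist X) (Q_hull Y dY) (Q_dist Y)"
  have "?G / 3 \<le> gromov_hausdorff X dX Y dY"
    unfolding gromov_hausdorff_def[of X]
  proof (rule Inf_greatest, clarify)
    fix \<epsilon> :: real and Z :: "('a + 'b) set" and dZ i j
    assume \<epsilon>: "0 < \<epsilon>" and "quasi_metric Z dZ"
      and "isometric_embedding X dX Z dZ i" "isometric_embedding Y dY Z dZ j"
      and "hausdorff_Sym dZ (i ` X) (j ` Y) < ennreal \<epsilon>"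
    then obtain R where R: "correspondence X Y R" and dist: "distortion_le dX dY R (2 * \<epsilon>)"
      using correspondence_of_hausdorff by metis
    have "?G \<le> ennreal (3 * \<epsilon>)"
      using \<epsilon> by (intro gromov_hausdorff_le_of_correspondence[OF quasi_metric_Q_hull[OF X]
            quasi_metric_Q_hull[OF Y] correspondence_hull_correspondence[OF R dist]
            distortion_le_hull_correspondence[OF X Y R]]) auto
    then show "?G / 3 \<le> ennreal \<epsilon>"
      using \<epsilon> by (intro divide_le_posI_ennreal) (simp_all add: ennreal_mult mult.commute)
  qed
  then have "3 * (?G / 3) \<le> 3 * gromov_hausdorff X dX Y dY"
    by (rule mult_left_mono) simp
  moreover have "3 * (?G / 3) = ?G"
    using ennreal_mult_divide_eq[of 3 ?G] by (simp add: ennreal_times_divide mult.commute)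
  ultimately show ?thesis by simp
qed

theorem theorem4p1:
  fixes X :: "'a set" and dX :: "'a \<Rightarrow> 'a \<Rightarrow> real"
    and Y :: "'b set" and dY :: "'b \<Rightarrow> 'b \<Rightarrow> real"
  assumes "quasi_metric X dX" and "quasi_metric Y dY"
  shows "gromov_hausdorff (Q_hull X dX) (Q_dist X) (Q_hull Y dY) (Q_dist Y)
           \<le> 8 * gromov_hausdorff X dX Y dY"
proof -
  have "3 * gromov_hausdorff X dX Y dY \<le> 8 * gromov_hausdorff X dX Y dY"
    by (rule mult_right_mono) simp_all
  with gromov_hausdorff_Q_hull_le_3[OF assms] show ?thesis by (rule order_trans)
qed

end
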